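(* Let $(\Omega_S,\mathfrak F_S,\mu)$ and $(\Omega_T,\mathfrak F_T,\nu)$ be two probability spaces, where $\mu$ and $\nu$ have densities (also denoted $\mu,\nu$) with respect to a dominating measure $\lambda$. Let $\boldsymbol{\Pi}_{\mathcal K}$ be the set of joint pdfs $\pi(x,y)$ on $\Omega_S\times\Omega_T$ with marginals $\mu$ and $\nu$, i.e. $\int_{\Omega_T}\pi(x,y)\,d\lambda(y)=\mu(x)$ and $\int_{\Omega_S}\pi(x,y)\,d\lambda(x)=\nu(y)$. Let $\phi$ be a fixed pdf on $\Omega_S\times\Omega_T$ which dominates every $\pi\in\boldsymbol{\Pi}_{\mathcal K}$, i.e. $\pi\ll\phi$. Let $c:\Omega_S\times\Omega_T\to[0,\infty)$ be a measurable cost function and let $\epsilon>0$. Define the ideal design (extended Gibbs kernel) $$\pi^{I}(x,y)=\exp\Bigl(\frac{-c(x,y)}{\epsilon}\Bigr)\frac{\phi(x,y)}{\mathcal N_{\phi,\epsilon}},\qquad \mathcal N_{\phi,\epsilon}=\int_{\Omega_S\times\Omega_T}\exp\Bigl(\frac{-c(x,y)}{\epsilon}\Bigr)\phi(x,y)\,d\lambda(x,y).$$ Then the Fully Probabilistic Design problem with ideal design $\pi^I$ and the $\phi$-regularised optimal transport problem have the same solution: $$\operatorname*{argmin}_{\pi\in\boldsymbol{\Pi}_{\mathcal K},\ \pi\ll\pi^I} KL(\pi\,\|\,\pi^{I})=\operatorname*{argmin}_{\pi\in\boldsymbol{\Pi}_{\mathcal K}}\left\{\int_{\Omega_S\ti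mes\Omega_T}c(x,y)\pi(x,y)\,d\lambda(x,y)+\epsilon\,KL(\pi\,\|\,\phi)\right\}.$$
   Context: The dominating measure $\lambda$ is the Lebesgue measure or the counting measure (on $\Omega_S$, on $\Omega_T$, and correspondingly the product reference measure on $\Omega_S\times\Omega_T$). A pdf is a probability density with respect to $\lambda$ (a probability mass function in the discrete case); pdfs are identified with the probability measures they define, so they are considered up to $\lambda$-a.e. equality, and $\pi\ll\zeta$ means absolute continuity of the corresponding measures. For pdfs $\pi,\zeta$ on $\Omega_S\times\Omega_T$, the Kullback-Leibler divergence is $$KL(\pi\,\|\,\zeta)=\int_{\Omega_S\times\Omega_T}\pi(x,y)\log\Bigl(\frac{\pi(x,y)}{\zeta(x,y)}\Bigr)d\lambda(x,y)\ \text{ if }\pi\ll\zeta,\qquad KL(\pi\,\|\,\zeta)=+\infty\ \text{ otherwise.}$$ Objective functionals take values in $[0,+\infty]$, and $\operatorname{argmin}$ denotes the set of minimizers over the indicated feasible set. *)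

theory Defs
  imports "HOL-Probability.Probability"
begin

(* Probability densities are real-valued representatives, non-negative on all of space M.
   Nothing is required outside space M. *)
definition is_pdf :: "'a measure \<Rightarrow> ('a \<Rightarrow> real) \<Rightarrow> bool" where
  "is_pdf M f \<longleftrightarrow> f \<in> borel_measurable M \<and> (\<forall>x\<in>space M. 0 \<le> f x) \<and>
     (\<integral>\<^sup>+x. ennreal (f x) \<partial>M) = 1"

(* Note the argument order of the library constant: absolutely_continuous P Q means Q << P. *)
definition pdf_ac :: "'a measure \<Rightarrow> ('a \<Rightarrow> real) \<Rightarrow> ('a \<Rightarrow> real) \<Rightarrow> bool" where
  "pdf_ac M p z \<longleftrightarrow>
     absolutely_continuous (density M (\<lambda>x. ennreal (z x))) (density M (\<lambda>x. ennreal (p x)))"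

(* The Bochner integral is 0 on non-integrable functions; this one can be infinite.
   It is meaningful as soon as one of the two parts is finite. *)
definition ext_integral :: "'a measure \<Rightarrow> ('a \<Rightarrow> real) \<Rightarrow> ereal" where
  "ext_integral M f =
     enn2ereal (\<integral>\<^sup>+x. ennreal (f x) \<partial>M) - enn2ereal (\<integral>\<^sup>+x. ennreal (- f x) \<partial>M)"

(* The library constant KL_divergence is real-valued and cannot express the value infinity.
   The convention 0 * log (0 / z) = 0 holds automatically.  For pdfs p << z the negative part
   of the integrand has integral at most 1, because t * ln (t / s) >= t - s, so the
   extended integral is meaningful. *)
definition KL :: "'a measure \<Rightarrow> ('a \<Rightarrow> real) \<Rightarrow> ('a \<Rightarrow> real) \<Rightarrow> ereal" where
  "KL M p z =
     (if pdf_ac M p z then ext_integral M (\<lambda>x. p x * ln (p x / z x)) else \<infinity>)"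

(* The marginal conditions are equalities of densities, hence hold almost everywhere. *)
definition couplings ::
  "'a measure \<Rightarrow> 'b measure \<Rightarrow> ('a \<Rightarrow> real) \<Rightarrow> ('b \<Rightarrow> real) \<Rightarrow> ('a \<times> 'b \<Rightarrow> real) set" where
  "couplings M1 M2 \<mu> \<nu> =
     {\<pi>. is_pdf (M1 \<Otimes>\<^sub>M M2) \<pi> \<and>
         (AE x in M1. (\<integral>\<^sup>+y. ennreal (\<pi> (x, y)) \<partial>M2) = ennreal (\<mu> x)) \<and>
         (AE y in M2. (\<integral>\<^sup>+x. ennreal (\<pi> (x, y)) \<partial>M1) = ennreal (\<nu> y))}"

definition gibbs_norm :: "'a measure \<Rightarrow> ('a \<Rightarrow> real) \<Rightarrow> ('a \<Rightarrow> real) \<Rightarrow> real \<Rightarrow> real" where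
  "gibbs_norm M c \<phi> \<epsilon> = (\<integral>z. exp (- c z / \<epsilon>) * \<phi> z \<partial>M)"

definition ideal_design ::
  "'a measure \<Rightarrow> ('a \<Rightarrow> real) \<Rightarrow> ('a \<Rightarrow> real) \<Rightarrow> real \<Rightarrow> 'a \<Rightarrow> real" where
  "ideal_design M c \<phi> \<epsilon> = (\<lambda>z. exp (- c z / \<epsilon>) * (\<phi> z / gibbs_norm M c \<phi> \<epsilon>))"

definition reg_ot_objective ::
  "'a measure \<Rightarrow> ('a \<Rightarrow> real) \<Rightarrow> ('a \<Rightarrow> real) \<Rightarrow> real \<Rightarrow> ('a \<Rightarrow> real) \<Rightarrow> ereal" where
  "reg_ot_objective M c \<phi> \<epsilon> \<pi> =
     enn2ereal (\<integral>\<^sup>+z. ennreal (c z * \<pi> z) \<partial>M) + ereal \<epsilon> * KL M \<pi> \<phi>"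

(* For sets of pdfs the result is a set of representatives, closed under almost-everywhere
   modification whenever the feasible set and the objective respect it. *)
definition argmin_set :: "('a \<Rightarrow> ereal) \<Rightarrow> 'a set \<Rightarrow> 'a set" where
  "argmin_set F S = {p. is_arg_min F (\<lambda>q. q \<in> S) p}"

end

theory Submission
  imports Defs
begin

text \<open>
  The density \<open>\<phi>\<close> and the Gibbs kernel \<open>\<pi>\<^sup>I\<close> have the same zeros, so domination by one is
  domination by the other. For a pdf \<open>\<pi>\<close> dominated by \<open>\<phi>\<close>, the logarithm of the Gibbs kernel
  splits off \<open>c / \<epsilon>\<close> and \<open>ln N\<close>, whence
  \<open>\<epsilon> KL(\<pi> | \<pi>\<^sup>I) = \<integral> c \<pi> + \<epsilon> KL(\<pi> | \<phi>) + \<epsilon> ln N\<close>. The two objectives thus differ by a strictly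
  increasing affine map with finite coefficients. All sums are legitimate in the extended reals
  because the negative parts of the integrands have finite integral.
\<close>

section \<open>Calculus of the extended integral\<close>

lemma ext_integral_cong_AE:
  assumes "AE x in M. f x = g x"
  shows "ext_integral M f = ext_integral M g"
proof -
  have "(\<integral>\<^sup>+x. ennreal (f x) \<partial>M) = (\<integral>\<^sup>+x. ennreal (g x) \<partial>M)"
    "(\<integral>\<^sup>+x. ennreal (- f x) \<partial>M) = (\<integral>\<^sup>+x. ennreal (- g x) \<partial>M)"
    by (rule nn_integral_cong_AE, use assms in auto)+
  then show ?thesis by (simp add: ext_integral_def)
qed

lemma ext_integral_nonneg:
  assumes "\<And>x. x \<in> space M \<Longrightarrow> 0 \<le> f x"
  shows "ext_integral M f = enn2ereal (\<integral>\<^sup>+x. ennreal (f x) \<partial>M)"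
proof -
  have "(\<integral>\<^sup>+x. ennreal (- f x) \<partial>M) = (\<integral>\<^sup>+x. 0 \<partial>M)"
    by (rule nn_integral_cong) (simp add: assms ennreal_neg)
  then show ?thesis by (simp add: ext_integral_def zero_ennreal.rep_eq)
qed

lemma ext_integral_integrable:
  assumes "integrable M f"
  shows "ext_integral M f = ereal (\<integral>x. f x \<partial>M)"
proof -
  let ?p = "\<integral>\<^sup>+x. ennreal (f x) \<partial>M" and ?n = "\<integral>\<^sup>+x. ennreal (- f x) \<partial>M"
  have "?p < \<infinity>" "?n < \<infinity>"
    using assms by (auto simp: real_integrable_def top.not_eq_extremum)
  then show ?thesis
    by (cases ?p; cases ?n) (auto simp: ext_integral_def real_lebesgue_integral_def[OF assms])
qed

lemma ext_integral_not_MInfty: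
  assumes "(\<integral>\<^sup>+x. ennreal (- f x) \<partial>M) < \<infinity>"
  shows "ext_integral M f \<noteq> - \<infinity>"
  using assms
  by (cases "\<integral>\<^sup>+x. ennreal (f x) \<partial>M"; cases "\<integral>\<^sup>+x. ennreal (- f x) \<partial>M")
    (auto simp: ext_integral_def)

text \<open>Turns a subtraction-free identity in \<open>ennreal\<close> into one between differences
  in \<open>ereal\<close>. Finiteness of \<open>B\<close>, \<open>b1\<close>, \<open>b2\<close>
  excludes \<infinity> - \<infinity>, while \<open>A\<close>, \<open>a1\<close>, \<open>a2\<close>
  may be infinite.\<close>

lemma enn2ereal_diff_add:
  assumes "A + (b1 + b2) = B + (a1 + a2)" and "b1 < \<infinity>" "b2 < \<infinity>" "B < \<infinity>"
  shows "enn2ereal A - enn2ereal B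
    = (enn2ereal a1 - enn2ereal b1) + (enn2ereal a2 - enn2ereal b2)"
  using assms
  by (cases A; cases B; cases a1; cases a2; cases b1; cases b2)
    (auto simp: ennreal_plus[symmetric] simp del: ennreal_plus)

text \<open>Moving all negative parts across gives a pointwise identity between sums of non-negative
  terms, which can be integrated termwise and rearranged afterwards. Integrals of the positive parts
  may be infinite.\<close>

lemma ext_integral_add:
  assumes [measurable]: "f \<in> borel_measurable M" "g \<in> borel_measurable M"
    and f: "(\<integral>\<^sup>+x. ennreal (- f x) \<partial>M) < \<infinity>" and g: "(\<integral>\<^sup>+x. ennreal (- g x) \<partial>M) < \<infinity>"
  shows "ext_integral M (\<lambda>x. f x + g x) = ext_integral M f + ext_integral M g"
proof -
  have split: "ennreal (a + b) + (ennreal (- a) + ennreal (- b))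
      = ennreal (- (a + b)) + (ennreal a + ennreal b)" for a b :: real
    by (cases "0 \<le> a"; cases "0 \<le> b"; cases "0 \<le> a + b")
      (auto simp: ennreal_neg ennreal_plus[symmetric] simp del: ennreal_plus)
  \<comment> \<open>Subadditivity of the negative part bounds that of the sum, as the rearrangement
    requires.\<close>
  have "ennreal (- (a + b)) \<le> ennreal (- a) + ennreal (- b)" for a b :: real
    by (cases "0 \<le> a"; cases "0 \<le> b")
      (auto simp: ennreal_neg ennreal_plus[symmetric] ennreal_leI simp del: ennreal_plus)
  then have "(\<integral>\<^sup>+x. ennreal (- (f x + g x)) \<partial>M)
      \<le> (\<integral>\<^sup>+x. ennreal (- f x) + ennreal (- g x) \<partial>M)"
    by (intro nn_integral_mono) blast
  also have "\<dots> < \<infinity>"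
    using f g by (simp add: nn_integral_add)
  finally have B: "(\<integral>\<^sup>+x. ennreal (- (f x + g x)) \<partial>M) < \<infinity>" .
  have "(\<integral>\<^sup>+x. ennreal (f x + g x) + (ennreal (- f x) + ennreal (- g x)) \<partial>M)
      = (\<integral>\<^sup>+x. ennreal (- (f x + g x)) + (ennreal (f x) + ennreal (g x)) \<partial>M)"
    by (simp only: split)
  then have "(\<integral>\<^sup>+x. ennreal (f x + g x) \<partial>M)
      + ((\<integral>\<^sup>+x. ennreal (- f x) \<partial>M) + (\<integral>\<^sup>+x. ennreal (- g x) \<partial>M))
    = (\<integral>\<^sup>+x. ennreal (- (f x + g x)) \<partial>M)
      + ((\<integral>\<^sup>+x. ennreal (f x) \<partial>M) + (\<integral>\<^sup>+x. ennreal (g x) \<partial>M))"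
    by (simp add: nn_integral_add)
  from enn2ereal_diff_add[OF this f g B] show ?thesis
    by (simp add: ext_integral_def)
qed

section \<open>Probability densities and absolute continuity\<close>

lemma is_pdf_integrable:
  assumes "is_pdf M p"
  shows "integrable M p" and "(\<integral>x. p x \<partial>M) = 1"
proof -
  have [measurable]: "p \<in> borel_measurable M" and nn: "AE x in M. 0 \<le> p x"
    and 1: "(\<integral>\<^sup>+x. ennreal (p x) \<partial>M) = 1"
    using assms by (auto simp: is_pdf_def)
  show "integrable M p" using nn 1 by (intro integrableI_nonneg) auto
  show "(\<integral>x. p x \<partial>M) = 1" using nn 1 by (subst integral_eq_nn_integral) auto
qed

text \<open>The zero set of \<open>z\<close> is null for the measure with density \<open>z\<close>,
  hence for the one with density \<open>p\<close>, so \<open>p\<close> vanishes almost everywhere on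
  it.\<close>

lemma pdf_ac_AE_zero:
  assumes "is_pdf M p" "is_pdf M z" "pdf_ac M p z"
  shows "AE x in M. z x = 0 \<longrightarrow> p x = 0"
proof -
  have [measurable]: "p \<in> borel_measurable M" "z \<in> borel_measurable M"
    and nn: "\<And>x. x \<in> space M \<Longrightarrow> 0 \<le> p x"
    using assms by (auto simp: is_pdf_def)
  let ?Z = "{x \<in> space M. z x = 0}"
  have "?Z \<in> null_sets (density M (\<lambda>x. ennreal (z x)))"
    by (auto simp: null_sets_density_iff)
  with assms(3) have "?Z \<in> null_sets (density M (\<lambda>x. ennreal (p x)))"
    by (auto simp: pdf_ac_def absolutely_continuous_def)
  then have "AE x in M. x \<in> ?Z \<longrightarrow> ennreal (p x) = 0"
    by (simp add: null_sets_density_iff)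
  then show ?thesis
    using AE_space by eventually_elim (use nn in \<open>auto simp: ennreal_eq_0_iff intro: antisym\<close>)
qed

text \<open>The null sets of a density depend only on where it vanishes. The condition reads \<le> 0
  because \<open>ennreal\<close> sends negative values to 0.\<close>

lemma pdf_ac_cong:
  assumes "z \<in> borel_measurable M" "w \<in> borel_measurable M"
    and "\<And>x. x \<in> space M \<Longrightarrow> z x \<le> 0 \<longleftrightarrow> w x \<le> 0"
  shows "pdf_ac M p z \<longleftrightarrow> pdf_ac M p w"
proof -
  have "null_sets (density M (\<lambda>x. ennreal (z x))) = null_sets (density M (\<lambda>x. ennreal (w x)))"
    using assms
    by (auto simp: null_sets_density_iff ennreal_eq_0_iff elim!: AE_mp intro!: AE_I2
        dest: sets.sets_into_space)
  then show ?thesis by (simp add: pdf_ac_def absolutely_continuous_def)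
qed

text \<open>Since ln t \<le> t - 1 at t = z / p, one has p * ln (z / p) \<le> z - p \<le> z. In the
  degenerate cases the left side is 0, by the conventions p / 0 = 0 and ln 0 = 0.\<close>

lemma entropy_integrand_lower_bound:
  assumes "0 \<le> p" "0 \<le> (z::real)"
  shows "- (p * ln (p / z)) \<le> z"
proof (cases "p = 0 \<or> z = 0")
  case False
  with assms have pos: "0 < p" "0 < z" by auto
  then have "p * ln (z / p) \<le> p * (z / p - 1)"
    by (intro mult_left_mono ln_le_minus_one) auto
  with pos show ?thesis by (simp add: ln_div algebra_simps)
qed (use assms in auto)

lemma entropy_integrand_neg_finite:
  assumes "is_pdf M p" "is_pdf M z"
  shows "(\<integral>\<^sup>+x. ennreal (- (p x * ln (p x / z x))) \<partial>M) < \<infinity>"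
proof -
  have "(\<integral>\<^sup>+x. ennreal (- (p x * ln (p x / z x))) \<partial>M) \<le> (\<integral>\<^sup>+x. ennreal (z x) \<partial>M)"
    using assms by (intro nn_integral_mono ennreal_leI entropy_integrand_lower_bound)
      (auto simp: is_pdf_def)
  also have "\<dots> < \<infinity>" using assms by (simp add: is_pdf_def)
  finally show ?thesis .
qed

section \<open>The Gibbs kernel and the affine relation between the objectives\<close>

context
  fixes M :: "'a measure" and c \<phi> :: "'a \<Rightarrow> real" and \<epsilon> :: real
  assumes phi: "is_pdf M \<phi>"
    and c_meas [measurable]: "c \<in> borel_measurable M"
    and c_nonneg: "\<And>x. x \<in> space M \<Longrightarrow> 0 \<le> c x"
    and eps: "0 < \<epsilon>"
begin

lemma phi_meas [measurable]: "\<phi> \<in> borel_measurable M"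
  and phi_nonneg: "x \<in> space M \<Longrightarrow> 0 \<le> \<phi> x"
  using phi by (auto simp: is_pdf_def)

lemma gibbs_norm_pos: "0 < gibbs_norm M c \<phi> \<epsilon>"
proof -
  let ?f = "\<lambda>z. exp (- c z / \<epsilon>) * \<phi> z"
  \<comment> \<open>As \<open>c\<close> is non-negative, the exponential is at most 1 and
    \<open>\<phi>\<close> is a majorant. Integrability matters because the Bochner integral defaults
    to 0.\<close>
  have int: "integrable M ?f"
    using eps by (intro Bochner_Integration.integrable_bound[OF is_pdf_integrable(1)[OF phi]])
      (auto intro!: AE_I2 mult_left_le_one_le simp: abs_mult c_nonneg)
  have nn: "AE z in M. 0 \<le> ?f z"
    by (auto intro!: AE_I2 simp: phi_nonneg)
  have "(\<integral>z. ?f z \<partial>M) \<noteq> 0"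
  proof
    assume "(\<integral>z. ?f z \<partial>M) = 0"
    \<comment> \<open>The exponential never vanishes, so \<open>\<phi>\<close> would have to,
      against its total mass 1.\<close>
    then have "AE z in M. \<phi> z = 0"
      using integral_nonneg_eq_0_iff_AE[OF int nn] by simp
    then have "(\<integral>z. \<phi> z \<partial>M) = (\<integral>z. 0 \<partial>M)"
      by (intro integral_cong_AE) auto
    then show False using is_pdf_integrable(2)[OF phi] by simp
  qed
  with integral_nonneg_AE[OF nn] show ?thesis
    by (simp add: gibbs_norm_def)
qed

lemma pdf_ac_ideal_design_iff:
  "pdf_ac M \<pi> (ideal_design M c \<phi> \<epsilon>) \<longleftrightarrow> pdf_ac M \<pi> \<phi>"
  by (rule pdf_ac_cong)
    (use gibbs_norm_pos in \<open>auto simp: ideal_design_def mult_le_0_iff divide_le_0_iff\<close>)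

lemma KL_ideal_design:
  assumes pdf: "is_pdf M \<pi>" and ac: "pdf_ac M \<pi> \<phi>"
  shows "reg_ot_objective M c \<phi> \<epsilon> \<pi> + ereal (\<epsilon> * ln (gibbs_norm M c \<phi> \<epsilon>))
    = ereal \<epsilon> * KL M \<pi> (ideal_design M c \<phi> \<epsilon>)"
proof -
  define N where "N = gibbs_norm M c \<phi> \<epsilon>"
  have N: "0 < N" using gibbs_norm_pos by (simp add: N_def)
  have pi_meas [measurable]: "\<pi> \<in> borel_measurable M"
    and pi_nonneg: "\<And>x. x \<in> space M \<Longrightarrow> 0 \<le> \<pi> x"
    using pdf by (auto simp: is_pdf_def)
  \<comment> \<open>The three summands of the integrand against the Gibbs kernel: relative entropy,
    scaled cost and normaliser. The last integrates to \<open>ln N\<close> because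
    \<open>\<pi>\<close> has mass 1.\<close>
  let ?g = "\<lambda>x. \<pi> x * ln (\<pi> x / \<phi> x)"
  let ?h = "\<lambda>x. c x * \<pi> x / \<epsilon>"
  let ?k = "\<lambda>x. ln N * \<pi> x"
  have k: "integrable M ?k" "(\<integral>x. ?k x \<partial>M) = ln N"
    using is_pdf_integrable[OF pdf] by auto
  have h_nonneg: "0 \<le> ?h x" if "x \<in> space M" for x
    using that c_nonneg pi_nonneg eps by auto
  have h_neg: "(\<integral>\<^sup>+x. ennreal (- ?h x) \<partial>M) < \<infinity>"
  proof -
    have "(\<integral>\<^sup>+x. ennreal (- ?h x) \<partial>M) = (\<integral>\<^sup>+x. 0 \<partial>M)"
      by (rule nn_integral_cong) (use h_nonneg in \<open>simp add: ennreal_neg\<close>)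
    then show ?thesis by simp
  qed
  have k_neg: "(\<integral>\<^sup>+x. ennreal (- ?k x) \<partial>M) < \<infinity>"
    using k(1) unfolding real_integrable_def by (simp add: top.not_eq_extremum)
  have g_neg: "(\<integral>\<^sup>+x. ennreal (- ?g x) \<partial>M) < \<infinity>"
    by (rule entropy_integrand_neg_finite[OF pdf phi])
  \<comment> \<open>Additivity is applied twice, the outer time with this sum as second
    summand.\<close>
  have hk_neg: "(\<integral>\<^sup>+x. ennreal (- (?h x + ?k x)) \<partial>M) < \<infinity>"
  proof -
    have "(\<integral>\<^sup>+x. ennreal (- (?h x + ?k x)) \<partial>M) \<le> (\<integral>\<^sup>+x. ennreal (- ?k x) \<partial>M)"
      by (intro nn_integral_mono ennreal_leI) (use h_nonneg in simp)
    with k_neg show ?thesis by (rule le_less_trans[rotated])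
  qed
  \<comment> \<open>Where \<open>\<pi>\<close> vanishes both sides are 0. Elsewhere absolute
    continuity makes \<open>\<phi>\<close> positive almost everywhere, so the logarithm
    splits.\<close>
  have "AE x in M. \<pi> x * ln (\<pi> x / ideal_design M c \<phi> \<epsilon> x) = ?g x + (?h x + ?k x)"
    using pdf_ac_AE_zero[OF pdf phi ac] AE_space
  proof eventually_elim
    case (elim x)
    show ?case
    proof (cases "\<pi> x = 0")
      case False
      with elim pi_nonneg phi_nonneg have "0 < \<pi> x" "0 < \<phi> x"
        by (force simp: less_le)+
      with N eps show ?thesis
        by (simp add: ideal_design_def N_def[symmetric] ln_div ln_mult field_simps)
    qed simp
  qed
  then have "KL M \<pi> (ideal_design M c \<phi> \<epsilon>) = ext_integral M (\<lambda>x. ?g x + (?h x + ?k x))"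
    using ac by (simp add: KL_def pdf_ac_ideal_design_iff ext_integral_cong_AE)
  also have "\<dots> = ext_integral M ?g + (ext_integral M ?h + ext_integral M ?k)"
    using g_neg h_neg k_neg hk_neg by (simp add: ext_integral_add)
  also have "\<dots> = KL M \<pi> \<phi> + (ext_integral M ?h + ereal (ln N))"
    using ac by (simp only: KL_def ext_integral_integrable[OF k(1)] k(2) if_True)
  finally have *: "KL M \<pi> (ideal_design M c \<phi> \<epsilon>)
    = KL M \<pi> \<phi> + (ext_integral M ?h + ereal (ln N))" .
  have "(\<integral>\<^sup>+x. ennreal (c x * \<pi> x) \<partial>M) = (\<integral>\<^sup>+x. ennreal \<epsilon> * ennreal (?h x) \<partial>M)"
    using eps h_nonneg by (intro nn_integral_cong) (simp flip: ennreal_mult)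
  also have "\<dots> = ennreal \<epsilon> * (\<integral>\<^sup>+x. ennreal (?h x) \<partial>M)"
    by (rule nn_integral_cmult) measurable
  finally have "enn2ereal (\<integral>\<^sup>+x. ennreal (c x * \<pi> x) \<partial>M) = ereal \<epsilon> * ext_integral M ?h"
    using eps h_nonneg by (simp add: ext_integral_nonneg times_ennreal.rep_eq)
  \<comment> \<open>Only finite values and +\<infinity> remain for the final case
    distinction.\<close>
  moreover have "KL M \<pi> \<phi> \<noteq> - \<infinity>" "ext_integral M ?h \<noteq> - \<infinity>"
    using ac ext_integral_not_MInfty[OF g_neg] ext_integral_not_MInfty[OF h_neg]
    by (simp_all add: KL_def)
  ultimately show ?thesis
    using eps unfolding * reg_ot_objective_def N_def[symmetric]
    by (cases "KL M \<pi> \<phi>"; cases "ext_integral M ?h") (auto simp: algebra_simps)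
qed

end

text \<open>\<open>is_arg_min\<close> consults the objective only through strict comparisons of
  feasible points, so order-equivalent objectives suffice, infinite values included.\<close>

lemma argmin_set_cong_less:
  assumes "\<And>p q. p \<in> S \<Longrightarrow> q \<in> S \<Longrightarrow> F p < F q \<longleftrightarrow> G p < G q"
  shows "argmin_set F S = argmin_set G S"
  using assms by (auto simp: argmin_set_def is_arg_min_def)

theorem theorem1:
  fixes M1 P1 :: "'a measure" and M2 P2 :: "'b measure"
    and \<mu> :: "'a \<Rightarrow> real" and \<nu> :: "'b \<Rightarrow> real"
    and \<phi> c :: "'a \<times> 'b \<Rightarrow> real" and \<epsilon> :: real
  assumes reference: "(sigma_finite_measure M1 \<and> sigma_finite_measure M2) \<or>
      (M1 = count_space (space M1) \<and> M2 = count_space (space M2))"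
    and "prob_space P1" and "is_pdf M1 \<mu>" and "P1 = density M1 (\<lambda>x. ennreal (\<mu> x))"
    and "prob_space P2" and "is_pdf M2 \<nu>" and "P2 = density M2 (\<lambda>y. ennreal (\<nu> y))"
    and "is_pdf (M1 \<Otimes>\<^sub>M M2) \<phi>"
    and "\<And>\<pi>. \<pi> \<in> couplings M1 M2 \<mu> \<nu> \<Longrightarrow> pdf_ac (M1 \<Otimes>\<^sub>M M2) \<pi> \<phi>"
    and "c \<in> borel_measurable (M1 \<Otimes>\<^sub>M M2)"
    and "\<And>x y. x \<in> space M1 \<Longrightarrow> y \<in> space M2 \<Longrightarrow> 0 \<le> c (x, y)"
    and "0 < \<epsilon>"
  shows "argmin_set (\<lambda>\<pi>. KL (M1 \<Otimes>\<^sub>M M2) \<pi> (ideal_design (M1 \<Otimes>\<^sub>M M2) c \<phi> \<epsilon>))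
           {\<pi> \<in> couplings M1 M2 \<mu> \<nu>.
              pdf_ac (M1 \<Otimes>\<^sub>M M2) \<pi> (ideal_design (M1 \<Otimes>\<^sub>M M2) c \<phi> \<epsilon>)}
       = argmin_set (reg_ot_objective (M1 \<Otimes>\<^sub>M M2) c \<phi> \<epsilon>) (couplings M1 M2 \<mu> \<nu>)"
proof -
  let ?M = "M1 \<Otimes>\<^sub>M M2" and ?C = "couplings M1 M2 \<mu> \<nu>"
  let ?I = "ideal_design ?M c \<phi> \<epsilon>" and ?N = "gibbs_norm ?M c \<phi> \<epsilon>"
  note phi = assms(8) and dom = assms(9) and eps = assms(12)
  have c: "\<And>z. z \<in> space ?M \<Longrightarrow> 0 \<le> c z"
    using assms(11) by (auto simp: space_pair_measure)
  note gibbs = phi assms(10) c eps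
  have affine: "reg_ot_objective ?M c \<phi> \<epsilon> p + ereal (\<epsilon> * ln ?N) = ereal \<epsilon> * KL ?M p ?I"
    if "p \<in> ?C" for p
    using that dom by (intro KL_ideal_design[OF gibbs]) (auto simp: couplings_def)
  \<comment> \<open>By domination through \<open>\<phi>\<close>, the extra constraint excludes no
    coupling.\<close>
  have "{\<pi> \<in> ?C. pdf_ac ?M \<pi> ?I} = ?C"
    using dom by (auto simp: pdf_ac_ideal_design_iff[OF gibbs])
  moreover have "KL ?M p ?I < KL ?M q ?I
      \<longleftrightarrow> reg_ot_objective ?M c \<phi> \<epsilon> p < reg_ot_objective ?M c \<phi> \<epsilon> q"
    if "p \<in> ?C" "q \<in> ?C" for p q
  proof -
    have "KL ?M p ?I < KL ?M q ?I \<longleftrightarrow> ereal \<epsilon> * KL ?M p ?I < ereal \<epsilon> * KL ?M q ?I"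
      using eps by (cases "KL ?M p ?I"; cases "KL ?M q ?I") auto
    \<comment> \<open>The shift \<open>\<epsilon> * ln ?N\<close> is finite, so it cancels from the
      comparison even when an objective is infinite.\<close>
    also have "\<dots> \<longleftrightarrow> reg_ot_objective ?M c \<phi> \<epsilon> p < reg_ot_objective ?M c \<phi> \<epsilon> q"
      unfolding affine[OF that(1), symmetric] affine[OF that(2), symmetric]
      by (cases "reg_ot_objective ?M c \<phi> \<epsilon> p"; cases "reg_ot_objective ?M c \<phi> \<epsilon> q") auto
    finally show ?thesis .
  qed
  ultimately show ?thesis
    by (simp only:) (rule argmin_set_cong_less)
qed

end
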